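(* Let $\alpha > -1$ be a real number and let $M \in \mathcal{B}(\ell^2)$ be the generalized Cesàro matrix of order two, i.e. the operator on $\ell^2$ given by the lower triangular matrix $M = [m_{ij}]_{i,j\ge 0}$ with $m_{ij} = \frac{2(i+1-j)}{(i+1+\alpha)(i+2+\alpha)}$ for $0 \le j \le i$ and $m_{ij} = 0$ for $j > i$. Then $M$ is both posinormal and coposinormal.
   Context: $\ell^2$ is the Hilbert space of square-summable sequences indexed by $\{0,1,2,\dots\}$, and matrices act with respect to its standard orthonormal basis. The matrix $M$ is a bounded operator on $\ell^2$ for every $\alpha > -1$. For a Hilbert space $H$, $\mathcal{B}(H)$ denotes the bounded linear operators on $H$; an operator $T$ is positive if it is self-adjoint and $\langle Tf,f\rangle \ge 0$ for all $f\in H$. An operator $A \in \mathcal{B}(H)$ is posinormal if there is a positive operator $P \in \mathcal{B}(H)$ with $AA^* = A^*PA$, and coposinormal if there is a positive operator $Q \in \mathcal{B}(H)$ with $AQA^* = A^*A$. *)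

theory Defs
  imports "HOL-Analysis.Analysis"
begin

class scaleC =
  fixes scaleC :: "complex \<Rightarrow> 'a \<Rightarrow> 'a"  (infixr \<open>*\<^sub>C\<close> 75)

text \<open>
  The underlying real Hilbert space of a complex Hilbert space carries the inner product
  \<open>Re \<langle>x, y\<rangle>\<close>, which induces the same norm.  The complex inner product is linear in its first
  argument.
\<close>

class complex_hilbert = real_inner + complete_space + scaleC +
  fixes cinner :: "'a \<Rightarrow> 'a \<Rightarrow> complex"
  assumes scaleC_add_right: "a *\<^sub>C (x + y) = a *\<^sub>C x + a *\<^sub>C y"
    and scaleC_add_left: "(a + b) *\<^sub>C x = a *\<^sub>C x + b *\<^sub>C x"
    and scaleC_scaleC: "a *\<^sub>C b *\<^sub>C x = (a * b) *\<^sub>C x"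
    and scaleC_of_real: "complex_of_real r *\<^sub>C x = r *\<^sub>R x"
    and cinner_commute: "cinner x y = cnj (cinner y x)"
    and cinner_add_left: "cinner (x + y) z = cinner x z + cinner y z"
    and cinner_scaleC_left: "cinner (a *\<^sub>C x) y = a * cinner x y"
    and Re_cinner: "Re (cinner x y) = inner x y"

definition bounded_clinear :: "('a::complex_hilbert \<Rightarrow> 'b::complex_hilbert) \<Rightarrow> bool" where
  "bounded_clinear T \<longleftrightarrow> bounded_linear T \<and> (\<forall>c x. T (c *\<^sub>C x) = c *\<^sub>C T x)"

text \<open>
  For a bounded operator the adjoint exists by the Riesz representation theorem; uniqueness is
  \<open>cadjoint_eqI\<close> below.
\<close>

definition cadjoint :: "('a::complex_hilbert \<Rightarrow> 'a) \<Rightarrow> 'a \<Rightarrow> 'a" where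
  "cadjoint T = (THE S. \<forall>x y. cinner (T x) y = cinner x (S y))"

definition positive_operator :: "('a::complex_hilbert \<Rightarrow> 'a) \<Rightarrow> bool" where
  "positive_operator T \<longleftrightarrow>
     bounded_clinear T \<and> cadjoint T = T \<and> (\<forall>f. cinner (T f) f \<in> \<real>\<^sub>\<ge>\<^sub>0)"

definition posinormal :: "('a::complex_hilbert \<Rightarrow> 'a) \<Rightarrow> bool" where
  "posinormal A \<longleftrightarrow> bounded_clinear A \<and>
     (\<exists>P. positive_operator P \<and> A \<circ> cadjoint A = cadjoint A \<circ> P \<circ> A)"

definition coposinormal :: "('a::complex_hilbert \<Rightarrow> 'a) \<Rightarrow> bool" where
  "coposinormal A \<longleftrightarrow> bounded_clinear A \<and>
     (\<exists>Q. positive_operator Q \<and> A \<circ> Q \<circ> cadjoint A = cadjoint A \<circ> A)"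

lemma cadjoint_eqI:
  assumes "\<And>x y. cinner (T x) y = cinner x (S y)"
  shows "cadjoint T = S"
  unfolding cadjoint_def
proof (rule the_equality)
  show "\<forall>x y. cinner (T x) y = cinner x (S y)"
    using assms by blast
next
  fix S' assume S': "\<forall>x y. cinner (T x) y = cinner x (S' y)"
  show "S' = S"
  proof
    fix y
    have "inner x (S' y) = inner x (S y)" for x
      using assms[of x y] S' by (metis Re_cinner)
    then show "S' y = S y"
      by (metis vector_eq_rdot inner_commute)
  qed
qed


typedef ell2 = "{x :: nat \<Rightarrow> complex. summable (\<lambda>i. (cmod (x i))\<^sup>2)}"
  morphisms ell2_nth Abs_ell2
  by (rule exI[of _ "\<lambda>_. 0"]) simp

setup_lifting type_definition_ell2

lemma summable_ell2: "summable (\<lambda>i. (cmod (ell2_nth x i))\<^sup>2)"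
  using ell2_nth[of x] by simp

lemma ell2_add_aux:
  assumes "summable (\<lambda>i. (cmod (f i))\<^sup>2)" "summable (\<lambda>i. (cmod (g i))\<^sup>2)"
  shows "summable (\<lambda>i. (cmod (f i + g i))\<^sup>2)"
proof (rule summable_comparison_test'[where N = 0])
  show "summable (\<lambda>i. 2 * (cmod (f i))\<^sup>2 + 2 * (cmod (g i))\<^sup>2)"
    by (intro summable_add summable_mult assms)
  fix i
  have "(cmod (f i + g i))\<^sup>2 \<le> (cmod (f i) + cmod (g i))\<^sup>2"
    by (intro power_mono norm_triangle_ineq) auto
  also have "\<dots> \<le> 2 * (cmod (f i))\<^sup>2 + 2 * (cmod (g i))\<^sup>2"
    using zero_le_power2[of "cmod (f i) - cmod (g i)"]
    by (simp add: power2_eq_square algebra_simps)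
  finally show "norm ((cmod (f i + g i))\<^sup>2) \<le> 2 * (cmod (f i))\<^sup>2 + 2 * (cmod (g i))\<^sup>2"
    by simp
qed

lemma ell2_mult_aux:
  assumes "summable (\<lambda>i. (cmod (f i))\<^sup>2)" "summable (\<lambda>i. (cmod (g i))\<^sup>2)"
  shows "summable (\<lambda>i. f i * cnj (g i))"
proof (rule summable_comparison_test'[where N = 0])
  show "summable (\<lambda>i. (cmod (f i))\<^sup>2 + (cmod (g i))\<^sup>2)"
    by (intro summable_add assms)
  fix i
  have "0 \<le> (cmod (f i) - cmod (g i))\<^sup>2 + (cmod (f i))\<^sup>2 + (cmod (g i))\<^sup>2"
    by (intro add_nonneg_nonneg) auto
  then show "norm (f i * cnj (g i)) \<le> (cmod (f i))\<^sup>2 + (cmod (g i))\<^sup>2"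
    by (simp add: norm_mult power2_eq_square algebra_simps)
qed

instantiation ell2 :: real_vector
begin
lift_definition zero_ell2 :: ell2 is "\<lambda>_. 0" by simp
lift_definition plus_ell2 :: "ell2 \<Rightarrow> ell2 \<Rightarrow> ell2" is "\<lambda>x y i. x i + y i"
  by (rule ell2_add_aux)
lift_definition uminus_ell2 :: "ell2 \<Rightarrow> ell2" is "\<lambda>x i. - x i" by simp
lift_definition minus_ell2 :: "ell2 \<Rightarrow> ell2 \<Rightarrow> ell2" is "\<lambda>x y i. x i - y i"
  subgoal for x y using ell2_add_aux[of x "\<lambda>i. - y i"] by simp done
lift_definition scaleR_ell2 :: "real \<Rightarrow> ell2 \<Rightarrow> ell2" is "\<lambda>r x i. r *\<^sub>R x i"
  by (simp add: power_mult_distrib summable_mult)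
instance
  by standard (transfer; force simp: algebra_simps)+
end

instantiation ell2 :: scaleC
begin
lift_definition scaleC_ell2 :: "complex \<Rightarrow> ell2 \<Rightarrow> ell2" is "\<lambda>c x i. c * x i"
  by (simp add: norm_mult power_mult_distrib summable_mult)
instance ..
end

definition ell2_cinner :: "ell2 \<Rightarrow> ell2 \<Rightarrow> complex" where
  "ell2_cinner x y = (\<Sum>i. ell2_nth x i * cnj (ell2_nth y i))"

lemma ell2_cinner_sums:
  "(\<lambda>i. ell2_nth x i * cnj (ell2_nth y i)) sums ell2_cinner x y"
  unfolding ell2_cinner_def by (intro summable_sums ell2_mult_aux summable_ell2)

instantiation ell2 :: real_inner
begin
definition inner_ell2 :: "ell2 \<Rightarrow> ell2 \<Rightarrow> real" where
  "inner_ell2 x y = Re (ell2_cinner x y)"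
definition norm_ell2 :: "ell2 \<Rightarrow> real" where
  "norm_ell2 x = sqrt (inner x x)"
definition dist_ell2 :: "ell2 \<Rightarrow> ell2 \<Rightarrow> real" where
  "dist_ell2 x y = norm (x - y)"
definition sgn_ell2 :: "ell2 \<Rightarrow> ell2" where
  "sgn_ell2 x = inverse (norm x) *\<^sub>R x"
definition uniformity_ell2 :: "(ell2 \<times> ell2) filter" where
  "uniformity_ell2 = (INF e\<in>{0<..}. principal {(x, y). dist x y < e})"
definition open_ell2 :: "ell2 set \<Rightarrow> bool" where
  "open_ell2 U = (\<forall>x\<in>U. eventually (\<lambda>(x', y). x' = x \<longrightarrow> y \<in> U) uniformity)"

lemma inner_ell2_sums: "(\<lambda>i. Re (ell2_nth x i * cnj (ell2_nth y i))) sums inner x y"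
  unfolding inner_ell2_def using ell2_cinner_sums by (rule sums_Re)

lemma inner_self_ell2_sums: "(\<lambda>i. (cmod (ell2_nth x i))\<^sup>2) sums inner x x"
  using inner_ell2_sums[of x x] unfolding cmod_power2 by (simp add: power2_eq_square)

instance
proof
  fix x y z :: ell2 and r :: real
  show "inner x y = inner y x"
    using inner_ell2_sums[of x y] inner_ell2_sums[of y x]
    by (intro sums_unique2[OF inner_ell2_sums]) (simp add: mult.commute)
  show "inner (x + y) z = inner x z + inner y z"
    using sums_add[OF inner_ell2_sums[of x z] inner_ell2_sums[of y z]]
    by (intro sums_unique2[OF inner_ell2_sums]) (simp add: plus_ell2.rep_eq algebra_simps)
  show "inner (r *\<^sub>R x) y = r * inner x y"
    using sums_mult[OF inner_ell2_sums[of x y], of r]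
    by (intro sums_unique2[OF inner_ell2_sums]) (simp add: scaleR_ell2.rep_eq algebra_simps)
  show "0 \<le> inner x x"
    by (rule sums_le[OF _ sums_zero inner_self_ell2_sums]) simp
  show "inner x x = 0 \<longleftrightarrow> x = 0"
  proof
    assume "inner x x = 0"
    then have "(\<Sum>i. (cmod (ell2_nth x i))\<^sup>2) = 0"
      using inner_self_ell2_sums sums_unique by metis
    then have "\<forall>i. (cmod (ell2_nth x i))\<^sup>2 = 0"
      by (subst (asm) suminf_eq_zero_iff) (auto simp: summable_ell2)
    then show "x = 0"
      by transfer (auto simp: fun_eq_iff)
  next
    assume "x = 0"
    then show "inner x x = 0"
      using inner_self_ell2_sums[of x] by (auto simp: zero_ell2.rep_eq sums_iff)
  qed
qed (simp_all add: norm_ell2_def dist_ell2_def sgn_ell2_def uniformity_ell2_def open_ell2_def)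
end

lemma norm_ell2_sums: "(\<lambda>i. (cmod (ell2_nth x i))\<^sup>2) sums (norm x)\<^sup>2"
  using inner_self_ell2_sums[of x] by (simp add: power2_norm_eq_inner)

lemma sum_le_norm_ell2: "(\<Sum>i<n. (cmod (ell2_nth x i))\<^sup>2) \<le> (norm x)\<^sup>2"
  using norm_ell2_sums[of x] sum_le_suminf[OF summable_ell2, of "{..<n}" x]
  by (simp add: sums_iff)

lemma cmod_nth_le_norm_ell2: "cmod (ell2_nth x i) \<le> norm x"
proof (rule power2_le_imp_le)
  have "(cmod (ell2_nth x i))\<^sup>2 \<le> (\<Sum>j<Suc i. (cmod (ell2_nth x j))\<^sup>2)"
    by (rule member_le_sum) auto
  then show "(cmod (ell2_nth x i))\<^sup>2 \<le> (norm x)\<^sup>2"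
    using sum_le_norm_ell2[where n = "Suc i" and x = x] by linarith
qed simp

lemma ell2_bounded_partial_sums:
  assumes "\<And>n. (\<Sum>i<n. (cmod (f i))\<^sup>2) \<le> B\<^sup>2" "0 \<le> B"
  shows "summable (\<lambda>i. (cmod (f i))\<^sup>2)" and "norm (Abs_ell2 f) \<le> B"
proof -
  show *: "summable (\<lambda>i. (cmod (f i))\<^sup>2)"
    by (rule summableI_nonneg_bounded[where x = "B\<^sup>2"]) (use assms in auto)
  have "(norm (Abs_ell2 f))\<^sup>2 = (\<Sum>i. (cmod (f i))\<^sup>2)"
    using norm_ell2_sums[of "Abs_ell2 f"] * by (simp add: Abs_ell2_inverse sums_iff)
  also have "\<dots> \<le> B\<^sup>2"
    by (rule suminf_le_const[OF * assms(1)])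
  finally show "norm (Abs_ell2 f) \<le> B"
    using assms(2) by (rule power2_le_imp_le)
qed

instance ell2 :: complete_space
proof
  fix X :: "nat \<Rightarrow> ell2"
  assume X: "Cauchy X"
  have "Cauchy (\<lambda>n. ell2_nth (X n) i)" for i
  proof (rule CauchyI)
    fix e :: real assume "0 < e"
    then obtain M where M: "\<And>m n. m \<ge> M \<Longrightarrow> n \<ge> M \<Longrightarrow> norm (X m - X n) < e"
      using CauchyD[OF X] by metis
    have "norm (ell2_nth (X m) i - ell2_nth (X n) i) \<le> norm (X m - X n)" for m n
      using cmod_nth_le_norm_ell2[of "X m - X n" i] by (simp add: minus_ell2.rep_eq)
    then show "\<exists>M. \<forall>m\<ge>M. \<forall>n\<ge>M. norm (ell2_nth (X m) i - ell2_nth (X n) i) < e"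
      using M order.strict_trans1 by blast
  qed
  then obtain l where l: "\<And>i. (\<lambda>n. ell2_nth (X n) i) \<longlonglongrightarrow> l i"
    unfolding Cauchy_convergent_iff convergent_def by metis
  have bnd: "(\<Sum>i<k. (cmod (l i - ell2_nth (X n) i))\<^sup>2) \<le> e\<^sup>2"
    if "\<And>m. m \<ge> M \<Longrightarrow> norm (X m - X n) < e" for M n k e
  proof (rule tendsto_upperbound)
    show "(\<lambda>m. \<Sum>i<k. (cmod (ell2_nth (X m) i - ell2_nth (X n) i))\<^sup>2)
            \<longlonglongrightarrow> (\<Sum>i<k. (cmod (l i - ell2_nth (X n) i))\<^sup>2)"
      by (intro tendsto_intros l)
    have "(\<Sum>i<k. (cmod (ell2_nth (X m) i - ell2_nth (X n) i))\<^sup>2) \<le> e\<^sup>2" if "m \<ge> M" for m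
    proof -
      have "(\<Sum>i<k. (cmod (ell2_nth (X m) i - ell2_nth (X n) i))\<^sup>2) \<le> (norm (X m - X n))\<^sup>2"
        using sum_le_norm_ell2[where n = k and x = "X m - X n"] by (simp add: minus_ell2.rep_eq)
      also have "\<dots> \<le> e\<^sup>2"
        using \<open>\<And>m. m \<ge> M \<Longrightarrow> norm (X m - X n) < e\<close>[OF that] by (intro power_mono) auto
      finally show ?thesis .
    qed
    then show "\<forall>\<^sub>F m in sequentially.
        (\<Sum>i<k. (cmod (ell2_nth (X m) i - ell2_nth (X n) i))\<^sup>2) \<le> e\<^sup>2"
      unfolding eventually_sequentially by blast
  qed simp
  have tail: "\<exists>M. \<forall>n\<ge>M. \<forall>k. (\<Sum>i<k. (cmod (l i - ell2_nth (X n) i))\<^sup>2) \<le> e\<^sup>2"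
    if e: "0 < e" for e
  proof -
    obtain M where "\<And>m n. m \<ge> M \<Longrightarrow> n \<ge> M \<Longrightarrow> norm (X m - X n) < e"
      using CauchyD[OF X e] by metis
    then show ?thesis
      using bnd by blast
  qed
  have sl: "summable (\<lambda>i. (cmod (l i))\<^sup>2)"
  proof -
    obtain M where "\<forall>k. (\<Sum>i<k. (cmod (l i - ell2_nth (X M) i))\<^sup>2) \<le> 1\<^sup>2"
      using tail[of 1] by auto
    then have "summable (\<lambda>i. (cmod (l i - ell2_nth (X M) i))\<^sup>2)"
      by (intro ell2_bounded_partial_sums(1)[where B = 1]) auto
    from ell2_add_aux[OF this summable_ell2[of "X M"]] show ?thesis
      by simp
  qed
  have "X \<longlonglongrightarrow> Abs_ell2 l"
  proof (rule LIMSEQ_I)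
    fix e :: real assume "0 < e"
    then obtain M where
      M: "\<forall>n\<ge>M. \<forall>k. (\<Sum>i<k. (cmod (l i - ell2_nth (X n) i))\<^sup>2) \<le> (e / 2)\<^sup>2"
      using tail[of "e / 2"] by auto
    have "norm (X n - Abs_ell2 l) < e" if "n \<ge> M" for n
    proof -
      have "ell2_nth (Abs_ell2 l - X n) = (\<lambda>i. l i - ell2_nth (X n) i)"
        using sl by (simp add: minus_ell2.rep_eq Abs_ell2_inverse)
      then have eq: "Abs_ell2 l - X n = Abs_ell2 (\<lambda>i. l i - ell2_nth (X n) i)"
        by (metis ell2_nth_inverse)
      have "norm (Abs_ell2 l - X n) \<le> e / 2"
        unfolding eq using M that \<open>0 < e\<close>
        by (intro ell2_bounded_partial_sums(2)) auto
      then show ?thesis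
        using \<open>0 < e\<close> by (simp add: norm_minus_commute)
    qed
    then show "\<exists>M. \<forall>n\<ge>M. norm (X n - Abs_ell2 l) < e"
      by blast
  qed
  then show "convergent X"
    unfolding convergent_def by blast
qed

instantiation ell2 :: complex_hilbert
begin
definition cinner_ell2 :: "ell2 \<Rightarrow> ell2 \<Rightarrow> complex" where
  "cinner_ell2 = ell2_cinner"
instance
proof
  fix x y z :: ell2 and a b :: complex and r :: real
  show "a *\<^sub>C (x + y) = a *\<^sub>C x + a *\<^sub>C y"
    by transfer (simp add: algebra_simps)
  show "(a + b) *\<^sub>C x = a *\<^sub>C x + b *\<^sub>C x"
    by transfer (simp add: algebra_simps)
  show "a *\<^sub>C b *\<^sub>C x = (a * b) *\<^sub>C x"
    by transfer (simp add: algebra_simps)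
  show "complex_of_real r *\<^sub>C x = r *\<^sub>R x"
    by transfer (simp add: scaleR_conv_of_real)
  have "(\<lambda>i. cnj (ell2_nth y i * cnj (ell2_nth x i))) sums cnj (ell2_cinner y x)"
    using ell2_cinner_sums by (subst sums_cnj)
  then show "cinner x y = cnj (cinner y x)"
    unfolding cinner_ell2_def
    by (intro sums_unique2[OF ell2_cinner_sums]) (simp add: mult.commute)
  show "cinner (x + y) z = cinner x z + cinner y z"
    unfolding cinner_ell2_def
    using sums_add[OF ell2_cinner_sums[of x z] ell2_cinner_sums[of y z]]
    by (intro sums_unique2[OF ell2_cinner_sums]) (simp add: plus_ell2.rep_eq algebra_simps)
  show "cinner (a *\<^sub>C x) y = a * cinner x y"
    unfolding cinner_ell2_def
    using sums_mult[OF ell2_cinner_sums[of x y], of a]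
    by (intro sums_unique2[OF ell2_cinner_sums]) (simp add: scaleC_ell2.rep_eq algebra_simps)
  show "Re (cinner x y) = inner x y"
    by (simp add: cinner_ell2_def inner_ell2_def)
qed
end

text \<open>
  The operator on \<open>\<ell>\<^sup>2\<close> given by an infinite matrix.  This is meaningful only if all row sums
  converge and the resulting sequence is square-summable for every \<open>x\<close>.
\<close>

definition ell2_matrix_op :: "(nat \<Rightarrow> nat \<Rightarrow> complex) \<Rightarrow> ell2 \<Rightarrow> ell2" where
  "ell2_matrix_op m x = Abs_ell2 (\<lambda>i. \<Sum>j. m i j * ell2_nth x j)"


definition cesaro2_entry :: "real \<Rightarrow> nat \<Rightarrow> nat \<Rightarrow> real" where
  "cesaro2_entry \<alpha> i j =
     (if j \<le> i then 2 * (real i + 1 - real j) / ((real i + 1 + \<alpha>) * (real i + 2 + \<alpha>)) else 0)"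

definition cesaro2 :: "real \<Rightarrow> ell2 \<Rightarrow> ell2" where
  "cesaro2 \<alpha> = ell2_matrix_op (\<lambda>i j. complex_of_real (cesaro2_entry \<alpha> i j))"

lemma hardy_partial_sums:
  fixes a :: "nat \<Rightarrow> real"
  shows "(\<Sum>n<N. ((\<Sum>j\<le>n. a j) / real (Suc n))\<^sup>2) + 2 * (\<Sum>j<N. a j)\<^sup>2 / real N
           \<le> 4 * (\<Sum>n<N. (a n)\<^sup>2)"
proof (induction N)
  case 0
  then show ?case by simp
next
  case (Suc N)
  define S where "S = (\<Sum>j<N. a j)"
  have S: "(\<Sum>j\<le>N. a j) = S + a N" "(\<Sum>j<Suc N. a j) = S + a N"
    by (simp_all add: S_def lessThan_Suc_atMost[symmetric])
  define n where "n = real N"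
  have "((S + a N) / (n + 1))\<^sup>2 + 2 * (S + a N)\<^sup>2 / (n + 1) \<le> 4 * (a N)\<^sup>2 + 2 * S\<^sup>2 / n"
  proof (cases "N = 0")
    case True
    then show ?thesis
      by (simp add: S_def n_def)
  next
    case False
    then have n: "n > 0" by (simp add: n_def)
    define t where "t = (S + a N) / (n + 1)"
    have aN: "a N = (n + 1) * t - S"
      using n by (simp add: t_def)
    have "0 \<le> 4 * (a N)\<^sup>2 + 2 * S\<^sup>2 / n - (t\<^sup>2 + 2 * (n + 1) * t\<^sup>2)"
    proof -
      have "4 * (a N)\<^sup>2 + 2 * S\<^sup>2 / n - (t\<^sup>2 + 2 * (n + 1) * t\<^sup>2)
              = (2 * a N - t)\<^sup>2 + 2 * (S - n * t)\<^sup>2 / n"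
        using n by (simp add: aN field_simps power2_eq_square)
      also have "\<dots> \<ge> 0"
        using n by simp
      finally show ?thesis .
    qed
    moreover have "2 * (S + a N)\<^sup>2 / (n + 1) = 2 * (n + 1) * t\<^sup>2"
      using n by (simp add: t_def power2_eq_square divide_simps)
    ultimately show ?thesis
      by (simp add: t_def)
  qed
  then show ?case
    using Suc.IH by (simp add: S S_def[symmetric] n_def algebra_simps)
qed

lemma cesaro2_entry_bounds:
  assumes "\<alpha> > -1" "j \<le> i"
  shows "0 \<le> cesaro2_entry \<alpha> i j"
    and "cesaro2_entry \<alpha> i j \<le> 2 / min 1 (1 + \<alpha>) / real (Suc i)"
proof -
  define c where "c = min 1 (1 + \<alpha>)"
  have c: "0 < c" "c \<le> 1" "c \<le> 1 + \<alpha>"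
    using assms by (auto simp: c_def)
  have "c * real i \<le> real i"
    using c by (simp add: mult_left_le_one_le)
  then have 1: "c * (real i + 1) \<le> real i + 1 + \<alpha>"
    using c by (simp add: algebra_simps)
  have 2: "real i + 1 \<le> real i + 2 + \<alpha>"
    using assms by simp
  have pos: "0 < c * (real i + 1) * (real i + 1)"
    using c by simp
  have le: "c * (real i + 1) * (real i + 1) \<le> (real i + 1 + \<alpha>) * (real i + 2 + \<alpha>)"
    using c by (intro mult_mono 1 2) auto
  show "0 \<le> cesaro2_entry \<alpha> i j"
    using assms pos le by (auto simp: cesaro2_entry_def)
  have "cesaro2_entry \<alpha> i j \<le> 2 * (real i + 1) / (c * (real i + 1) * (real i + 1))"
    using assms pos le unfolding cesaro2_entry_def by (auto intro!: frac_le)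
  also have "\<dots> = 2 / c / real (Suc i)"
  proof -
    have "2 * n / (c * n * n) = 2 / c / n" if "n > 0" for n
      using c that by simp
    from this[of "real i + 1"] show ?thesis
      by (simp add: add.commute)
  qed
  finally show "cesaro2_entry \<alpha> i j \<le> 2 / min 1 (1 + \<alpha>) / real (Suc i)"
    by (simp add: c_def)
qed

lemma cesaro2_row:
  "(\<Sum>j. complex_of_real (cesaro2_entry \<alpha> i j) * f j)
     = (\<Sum>j\<le>i. complex_of_real (cesaro2_entry \<alpha> i j) * f j)"
  by (rule suminf_finite) (auto simp: cesaro2_entry_def)

lemma cesaro2_partial_sums:
  assumes "\<alpha> > -1"
  shows "(\<Sum>n<N. (cmod (\<Sum>j\<le>n. complex_of_real (cesaro2_entry \<alpha> n j) * ell2_nth x j))\<^sup>2)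
           \<le> (4 / min 1 (1 + \<alpha>) * norm x)\<^sup>2"
proof -
  define K where "K = 2 / min 1 (1 + \<alpha>)"
  have K: "0 \<le> K"
    using assms by (simp add: K_def)
  let ?a = "\<lambda>j. cmod (ell2_nth x j)"
  have row: "cmod (\<Sum>j\<le>n. complex_of_real (cesaro2_entry \<alpha> n j) * ell2_nth x j)
               \<le> K * ((\<Sum>j\<le>n. ?a j) / real (Suc n))" for n
  proof -
    have "cmod (\<Sum>j\<le>n. complex_of_real (cesaro2_entry \<alpha> n j) * ell2_nth x j)
            \<le> (\<Sum>j\<le>n. K / real (Suc n) * ?a j)"
    proof (rule sum_norm_le)
      fix j assume "j \<in> {..n}"
      then have "\<bar>cesaro2_entry \<alpha> n j\<bar> \<le> K / real (Suc n)"
        using cesaro2_entry_bounds[OF assms, of j n] by (simp add: K_def)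
      then have "\<bar>cesaro2_entry \<alpha> n j\<bar> * ?a j \<le> K / real (Suc n) * ?a j"
        by (rule mult_right_mono) simp
      then show "cmod (complex_of_real (cesaro2_entry \<alpha> n j) * ell2_nth x j)
                   \<le> K / real (Suc n) * ?a j"
        by (simp only: norm_mult norm_of_real)
    qed
    then show ?thesis
      by (simp add: sum_distrib_left sum_divide_distrib)
  qed
  have "(\<Sum>n<N. (cmod (\<Sum>j\<le>n. complex_of_real (cesaro2_entry \<alpha> n j) * ell2_nth x j))\<^sup>2)
          \<le> (\<Sum>n<N. (K * ((\<Sum>j\<le>n. ?a j) / real (Suc n)))\<^sup>2)"
    by (intro sum_mono power_mono row) auto
  also have "\<dots> = K\<^sup>2 * (\<Sum>n<N. ((\<Sum>j\<le>n. ?a j) / real (Suc n))\<^sup>2)"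
    by (simp only: power_mult_distrib sum_distrib_left)
  also have "\<dots> \<le> K\<^sup>2 * (4 * (\<Sum>n<N. (?a n)\<^sup>2))"
  proof (rule mult_left_mono)
    have "0 \<le> 2 * (\<Sum>j<N. ?a j)\<^sup>2 / real N"
      by simp
    then show "(\<Sum>n<N. ((\<Sum>j\<le>n. ?a j) / real (Suc n))\<^sup>2) \<le> 4 * (\<Sum>n<N. (?a n)\<^sup>2)"
      using hardy_partial_sums[of ?a N] by linarith
  qed simp
  also have "\<dots> \<le> K\<^sup>2 * (4 * (norm x)\<^sup>2)"
    using sum_le_norm_ell2 by (intro mult_left_mono) auto
  also have "\<dots> = (4 / min 1 (1 + \<alpha>) * norm x)\<^sup>2"
    by (simp add: K_def power2_eq_square)
  finally show ?thesis .
qed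

lemma cesaro2_nth:
  assumes "\<alpha> > -1"
  shows "ell2_nth (cesaro2 \<alpha> x) i
           = (\<Sum>j\<le>i. complex_of_real (cesaro2_entry \<alpha> i j) * ell2_nth x j)"
proof -
  have "0 \<le> 4 / min 1 (1 + \<alpha>) * norm x"
    using assms by simp
  from ell2_bounded_partial_sums(1)[OF cesaro2_partial_sums[OF assms] this]
  show ?thesis
    by (simp add: cesaro2_def ell2_matrix_op_def cesaro2_row Abs_ell2_inverse)
qed

lemma bounded_clinear_cesaro2:
  assumes "\<alpha> > -1"
  shows "bounded_clinear (cesaro2 \<alpha>)"
  unfolding bounded_clinear_def
proof (intro conjI allI bounded_linear_intro)
  fix x y :: ell2 and r :: real and c :: complex
  show "cesaro2 \<alpha> (x + y) = cesaro2 \<alpha> x + cesaro2 \<alpha> y"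
    by (simp add: ell2_nth_inject[symmetric] fun_eq_iff cesaro2_nth[OF assms] plus_ell2.rep_eq
        algebra_simps sum.distrib)
  show "cesaro2 \<alpha> (r *\<^sub>R x) = r *\<^sub>R cesaro2 \<alpha> x"
    by (simp add: ell2_nth_inject[symmetric] fun_eq_iff cesaro2_nth[OF assms] scaleR_ell2.rep_eq
        scaleR_sum_right)
  show "cesaro2 \<alpha> (c *\<^sub>C x) = c *\<^sub>C cesaro2 \<alpha> x"
    by (simp add: ell2_nth_inject[symmetric] fun_eq_iff cesaro2_nth[OF assms] scaleC_ell2.rep_eq
        sum_distrib_left mult.left_commute)
  have "0 \<le> 4 / min 1 (1 + \<alpha>) * norm x"
    using assms by simp
  from ell2_bounded_partial_sums(2)[OF cesaro2_partial_sums[OF assms] this]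
  show "norm (cesaro2 \<alpha> x) \<le> norm x * (4 / min 1 (1 + \<alpha>))"
    by (simp only: cesaro2_def ell2_matrix_op_def cesaro2_row mult.commute[of "norm x"])
qed

end

(* Let ' denote the adjoint.  Write M = D L^2 with D diagonal, d_i = 2 / ((i+1+a)(i+2+a)), and L the
   lower triangular all-ones matrix.  As L is inverted by a first difference, both M = M' T and
   M = U M' can be solved formally: T = D^-1 (I - S')^2 M and U = M D^-1 (I - S')^2 with S the
   unilateral shift.  Second differences lower the growth of the entries by two orders, so that those
   of T and U in row i are O(1/i) up to the first superdiagonal, bounded on the second and zero
   beyond; hence T and U are bounded by Hardy's inequality, and
   M M' = M' (T T') M, M' M = M (U' U) M'. *)

theory Submission
  imports Defs "HOL-Real_Asymp.Real_Asymp"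
begin

section \<open>Bounded operators and adjoints on \<open>\<ell>\<^sup>2\<close>\<close>

lemma cinner_zero_left: "cinner 0 (x::'a::complex_hilbert) = 0"
  using cinner_add_left[of 0 0 x] by simp

lemma cinner_scaleC_right: "cinner (x::'a::complex_hilbert) (a *\<^sub>C y) = cnj a * cinner x y"
  by (metis cinner_commute cinner_scaleC_left complex_cnj_mult)

lemma cinner_self: "cinner x x = complex_of_real ((norm (x::'a::complex_hilbert))\<^sup>2)"
proof -
  have "Im (cinner x x) = 0"
    using arg_cong[OF cinner_commute[of x x], of Im] by simp
  then show ?thesis
    by (simp add: complex_eq_iff Re_cinner power2_norm_eq_inner)
qed

lemma bounded_clinear_compose:
  assumes "bounded_clinear S" "bounded_clinear T"
  shows "bounded_clinear (S \<circ> T)"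
  using assms bounded_linear_compose[of S T] by (simp add: bounded_clinear_def comp_def)

section \<open>Standard basis vectors and finite truncations\<close>

definition ell2_unit :: "nat \<Rightarrow> ell2" where
  "ell2_unit j = Abs_ell2 (\<lambda>i. if i = j then 1 else 0)"

lemma ell2_nth_unit [simp]: "ell2_nth (ell2_unit j) i = (if i = j then 1 else 0)"
proof -
  have "summable (\<lambda>i. (cmod (if i = j then 1 else 0))\<^sup>2)"
    by (rule summable_finite[of "{j}"]) auto
  then show ?thesis
    by (simp add: ell2_unit_def Abs_ell2_inverse)
qed

lemma ell2_eqI: "(\<And>i. ell2_nth x i = ell2_nth y i) \<Longrightarrow> x = y"
  by (simp add: ell2_nth_inject[symmetric] fun_eq_iff)

lemma cinner_unit_right: "cinner x (ell2_unit j) = ell2_nth x j"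
proof -
  have "(\<lambda>i. ell2_nth x i * cnj (ell2_nth (ell2_unit j) i)) sums
          (\<Sum>i\<in>{j}. ell2_nth x i * cnj (ell2_nth (ell2_unit j) i))"
    by (rule sums_finite) auto
  then show ?thesis
    using sums_unique2[OF ell2_cinner_sums[of x "ell2_unit j"]] by (simp add: cinner_ell2_def)
qed

lemma ell2_nth_sum: "ell2_nth (\<Sum>j\<in>A. f j) i = (\<Sum>j\<in>A. ell2_nth (f j) i)"
  by (induction A rule: infinite_finite_induct) (simp_all add: zero_ell2.rep_eq plus_ell2.rep_eq)

lemma ell2_nth_truncation:
  "ell2_nth (\<Sum>j<n. c j *\<^sub>C ell2_unit j) i = (if i < n then c i else 0)"
  by (simp add: ell2_nth_sum scaleC_ell2.rep_eq if_distrib[of "\<lambda>x. _ * x"] cong: if_cong)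

lemma norm_truncation: "(norm (\<Sum>j<n. c j *\<^sub>C ell2_unit j))\<^sup>2 = (\<Sum>j<n. (cmod (c j))\<^sup>2)"
proof (rule sums_unique2[OF norm_ell2_sums])
  have "(\<lambda>i. if i \<in> {..<n} then (cmod (c i))\<^sup>2 else 0) sums (\<Sum>j<n. (cmod (c j))\<^sup>2)"
    by (rule sums_If_finite_set) simp
  then show "(\<lambda>i. (cmod (ell2_nth (\<Sum>j<n. c j *\<^sub>C ell2_unit j) i))\<^sup>2) sums
               (\<Sum>j<n. (cmod (c j))\<^sup>2)"
    by (simp add: ell2_nth_truncation if_distrib[of "\<lambda>x. (cmod x)\<^sup>2"] cong: if_cong)
qed

lemma truncation_tendsto: "(\<lambda>n. \<Sum>j<n. ell2_nth x j *\<^sub>C ell2_unit j) \<longlonglongrightarrow> x"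
proof -
  let ?t = "\<lambda>n. \<Sum>j<n. ell2_nth x j *\<^sub>C ell2_unit j"
  \<comment> \<open>Pythagoras: the squared error of a truncation is the tail of the norm
    series.\<close>
  have eq: "(norm (x - ?t n))\<^sup>2 = (norm x)\<^sup>2 - (\<Sum>j<n. (cmod (ell2_nth x j))\<^sup>2)" for n
  proof (rule sums_unique2[OF norm_ell2_sums])
    have "(\<lambda>i. if i \<in> {..<n} then (cmod (ell2_nth x i))\<^sup>2 else 0) sums
            (\<Sum>j<n. (cmod (ell2_nth x j))\<^sup>2)"
      by (rule sums_If_finite_set) simp
    from sums_diff[OF norm_ell2_sums this]
    show "(\<lambda>i. (cmod (ell2_nth (x - ?t n) i))\<^sup>2) sums
        ((norm x)\<^sup>2 - (\<Sum>j<n. (cmod (ell2_nth x j))\<^sup>2))"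
      by (rule sums_cong[THEN iffD1, rotated])
        (simp add: minus_ell2.rep_eq ell2_nth_truncation)
  qed
  have "(\<lambda>n. (norm x)\<^sup>2 - (\<Sum>j<n. (cmod (ell2_nth x j))\<^sup>2)) \<longlonglongrightarrow> (norm x)\<^sup>2 - (norm x)\<^sup>2"
    using norm_ell2_sums[of x] unfolding sums_def by (intro tendsto_intros)
  then have "(\<lambda>n. sqrt ((norm (x - ?t n))\<^sup>2)) \<longlonglongrightarrow> sqrt 0"
    unfolding eq by (intro tendsto_real_sqrt) simp
  then have "(\<lambda>n. x - ?t n) \<longlonglongrightarrow> 0"
    by (simp add: tendsto_norm_zero_iff)
  from tendsto_diff[OF tendsto_const[of x] this] show ?thesis
    by simp
qed

section \<open>Complex Cauchy-Schwarz inequality and existence of adjoints\<close>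

lemma cmod_cinner_le: "cmod (cinner x y) \<le> norm x * norm (y :: 'a::complex_hilbert)"
proof (cases "cinner x y = 0")
  case False
  \<comment> \<open>Rotating \<open>x\<close> by this phase makes the inner product real and
    nonnegative without changing the norm of \<open>x\<close>, so the real Cauchy-Schwarz inequality
    applies.\<close>
  define c where "c = cnj (sgn (cinner x y))"
  have c: "cmod c = 1"
    using False by (simp add: c_def norm_sgn)
  have "norm (c *\<^sub>C x) = norm x"
  proof -
    have "complex_of_real ((norm (c *\<^sub>C x))\<^sup>2) = c * cnj c * complex_of_real ((norm x)\<^sup>2)"
      by (simp only: cinner_self[symmetric] cinner_scaleC_left cinner_scaleC_right mult_ac)
    also have "c * cnj c = 1"
      using c by (simp add: complex_norm_square[symmetric])
    finally show ?thesis
      by (simp only: mult_1 of_real_eq_iff) simp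
  qed
  moreover have "cinner (c *\<^sub>C x) y = complex_of_real (cmod (cinner x y))"
    using False
    by (simp add: cinner_scaleC_left c_def sgn_div_norm scaleR_conv_of_real
        complex_norm_square[symmetric] power2_eq_square field_simps
        flip: of_real_mult complex_norm_square)
  ultimately show ?thesis
    using norm_cauchy_schwarz[of "c *\<^sub>C x" y] by (metis Re_cinner Re_complex_of_real)
qed simp

text \<open>\<open>cadjoint\<close> is a definite description, so an adjoint has to be exhibited.
  Its coordinates are forced by the values of \<open>T\<close> on the basis; the point is that they
  are square-summable with norm at most \<open>K * norm y\<close>.\<close>

lemma ell2_adjoint_exists:
  fixes T :: "ell2 \<Rightarrow> ell2"
  assumes T: "bounded_clinear T"
  shows "bounded_clinear (cadjoint T)"
    and "cinner (T x) y = cinner x (cadjoint T y)"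
proof -
  interpret bounded_linear T
    using T by (simp add: bounded_clinear_def)
  have Tc: "T (c *\<^sub>C x) = c *\<^sub>C T x" for c x
    using T by (simp add: bounded_clinear_def)
  obtain K where K: "0 \<le> K" "\<And>x. norm (T x) \<le> norm x * K"
    using nonneg_bounded by blast
  define c where "c y j = cinner y (T (ell2_unit j))" for y j
  have T_trunc: "cinner (T (\<Sum>j<n. a j *\<^sub>C ell2_unit j)) y = (\<Sum>j<n. a j * cnj (c y j))" for a n y
  proof (induction n)
    case (Suc n)
    then show ?case
      by (simp add: add Tc cinner_add_left cinner_scaleC_left c_def cinner_commute[of y])
  next
    case 0
    show ?case
      by (simp add: zero cinner_zero_left)
  qed
  have le: "(\<Sum>j<n. (cmod (c y j))\<^sup>2) \<le> (K * norm y)\<^sup>2" for y n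
  proof -
    \<comment> \<open>Testing \<open>T\<close> on the truncated candidate itself bounds the square
      of \<open>norm ?x\<close> by \<open>norm ?x * K * norm y\<close>, and one factor
      \<open>norm ?x\<close> cancels.\<close>
    let ?x = "\<Sum>j<n. c y j *\<^sub>C ell2_unit j"
    have "complex_of_real ((norm ?x)\<^sup>2) = cinner (T ?x) y"
      unfolding T_trunc norm_truncation
      by (simp add: complex_norm_square del: of_real_power)
    then have "(norm ?x)\<^sup>2 = cmod (cinner (T ?x) y)"
      by (metis norm_of_real abs_of_nonneg zero_le_power2)
    also have "\<dots> \<le> norm (T ?x) * norm y"
      by (rule cmod_cinner_le)
    also have "\<dots> \<le> norm ?x * K * norm y"
      by (intro mult_right_mono K) simp
    finally have "norm ?x * norm ?x \<le> norm ?x * (K * norm y)"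
      by (simp add: power2_eq_square mult.assoc)
    then have "norm ?x \<le> K * norm y"
      using K(1) by (cases "norm ?x = 0") (simp_all add: mult_le_cancel_left)
    then show ?thesis
      unfolding norm_truncation[symmetric] by (intro power_mono) auto
  qed
  define S where "S y = Abs_ell2 (c y)" for y
  have S_nth: "ell2_nth (S y) = c y" for y
    using ell2_bounded_partial_sums(1)[OF le] K(1) by (simp add: S_def Abs_ell2_inverse)
  have S_norm: "norm (S y) \<le> norm y * K" for y
    using ell2_bounded_partial_sums(2)[OF le, of y] K(1) by (simp add: S_def mult.commute)
  \<comment> \<open>Both sides are the limit of \<open>cinner (T (?t n)) y\<close> along the
    truncations of \<open>x\<close>: one by the series of the inner product, the other by continuity
    of \<open>T\<close>.\<close>
  have adj: "cinner (T x) y = cinner x (S y)" for x y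
  proof (rule LIMSEQ_unique)
    let ?t = "\<lambda>n. \<Sum>j<n. ell2_nth x j *\<^sub>C ell2_unit j"
    show "(\<lambda>n. cinner (T (?t n)) y) \<longlonglongrightarrow> cinner x (S y)"
      using ell2_cinner_sums[of x "S y"] unfolding T_trunc
      by (simp add: sums_def cinner_ell2_def S_nth)
    have "(\<lambda>n. T (?t n)) \<longlonglongrightarrow> T x"
      by (intro tendsto truncation_tendsto)
    then have "(\<lambda>n. norm (T (?t n) - T x) * norm y) \<longlonglongrightarrow> 0"
      by (intro tendsto_mult_left_zero) (simp add: LIM_zero_iff tendsto_norm_zero_iff)
    then have "(\<lambda>n. cinner (T (?t n)) y - cinner (T x) y) \<longlonglongrightarrow> 0"
    proof (rule Lim_null_comparison[rotated])
      show "\<forall>\<^sub>F n in sequentially. norm (cinner (T (?t n)) y - cinner (T x) y)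
                \<le> norm (T (?t n) - T x) * norm y"
        by (intro always_eventually allI)
          (metis cmod_cinner_le cinner_add_left diff_add_cancel add_diff_cancel_right')
    qed
    then show "(\<lambda>n. cinner (T (?t n)) y) \<longlonglongrightarrow> cinner (T x) y"
      by (simp add: LIM_zero_iff)
  qed
  have "cadjoint T = S"
    by (rule cadjoint_eqI) (rule adj)
  moreover have "bounded_clinear S"
    unfolding bounded_clinear_def
  proof (intro conjI allI bounded_linear_intro[where K = K])
    fix x y and r :: real and a :: complex
    show "S (x + y) = S x + S y"
      by (rule ell2_eqI) (simp add: S_nth plus_ell2.rep_eq c_def cinner_add_left)
    show "S (a *\<^sub>C x) = a *\<^sub>C S x" for a
      by (rule ell2_eqI) (simp add: S_nth scaleC_ell2.rep_eq c_def cinner_scaleC_left)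
    then show "S (r *\<^sub>R x) = r *\<^sub>R S x"
      by (metis scaleC_of_real)
    show "norm (S x) \<le> norm x * K"
      by (rule S_norm)
  qed
  ultimately show "bounded_clinear (cadjoint T)" "cinner (T x) y = cinner x (cadjoint T y)"
    using adj by simp_all
qed

lemma ell2_adjoint_left:
  fixes T :: "ell2 \<Rightarrow> ell2"
  assumes "bounded_clinear T"
  shows "cinner (cadjoint T x) y = cinner x (T y)"
  by (metis assms cinner_commute ell2_adjoint_exists(2))

lemma cadjoint_cadjoint:
  fixes T :: "ell2 \<Rightarrow> ell2"
  assumes "bounded_clinear T"
  shows "cadjoint (cadjoint T) = T"
  by (rule cadjoint_eqI) (rule ell2_adjoint_left[OF assms])

lemma cadjoint_compose:
  fixes S T :: "ell2 \<Rightarrow> ell2"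
  assumes "bounded_clinear S" "bounded_clinear T"
  shows "cadjoint (S \<circ> T) = cadjoint T \<circ> cadjoint S"
  by (rule cadjoint_eqI) (simp add: assms ell2_adjoint_exists(2))

section \<open>Positive operators obtained from factorizations\<close>

lemma positive_operator_compose_cadjoint:
  fixes T :: "ell2 \<Rightarrow> ell2"
  assumes T: "bounded_clinear T"
  shows "positive_operator (T \<circ> cadjoint T)"
  unfolding positive_operator_def
proof (intro conjI allI)
  note T' = ell2_adjoint_exists(1)[OF T]
  show "bounded_clinear (T \<circ> cadjoint T)"
    by (rule bounded_clinear_compose[OF T T'])
  show "cadjoint (T \<circ> cadjoint T) = T \<circ> cadjoint T"
    by (simp add: cadjoint_compose[OF T T'] cadjoint_cadjoint[OF T])
  show "cinner ((T \<circ> cadjoint T) f) f \<in> \<real>\<^sub>\<ge>\<^sub>0" for f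
    by (simp add: ell2_adjoint_exists(2)[OF T] cinner_self del: of_real_power)
qed

text \<open>The easy half of Douglas' range inclusion criterion: \<open>A A\<^sup>* = A\<^sup>* (T T\<^sup>*) A\<close>.\<close>

lemma posinormalI:
  fixes A :: "ell2 \<Rightarrow> ell2"
  assumes A: "bounded_clinear A" and T: "bounded_clinear T" and eq: "A = cadjoint A \<circ> T"
  shows "posinormal A"
proof -
  have "cadjoint A = cadjoint T \<circ> A"
    using arg_cong[OF eq, of cadjoint]
    by (simp add: cadjoint_compose ell2_adjoint_exists(1) cadjoint_cadjoint A T)
  then have "A \<circ> cadjoint A = cadjoint A \<circ> (T \<circ> cadjoint T) \<circ> A"
    using eq by (metis comp_assoc)
  then show ?thesis
    unfolding posinormal_def using A positive_operator_compose_cadjoint[OF T] by blast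
qed

text \<open>Adjoints turn A = U A' into A' = A U', so A' A = A (U' U) A'. The positive operator U' U
  appears as \<open>cadjoint U\<close> composed with its own adjoint.\<close>

lemma coposinormalI:
  fixes A :: "ell2 \<Rightarrow> ell2"
  assumes A: "bounded_clinear A" and U: "bounded_clinear U" and eq: "A = U \<circ> cadjoint A"
  shows "coposinormal A"
proof -
  have "cadjoint A = A \<circ> cadjoint U"
    using arg_cong[OF eq, of cadjoint]
    by (simp add: cadjoint_compose ell2_adjoint_exists(1) cadjoint_cadjoint A U)
  then have "A \<circ> (cadjoint U \<circ> cadjoint (cadjoint U)) \<circ> cadjoint A = cadjoint A \<circ> A"
    using eq by (metis comp_assoc cadjoint_cadjoint[OF U])
  then show ?thesis
    unfolding coposinormal_def
    using A positive_operator_compose_cadjoint[OF ell2_adjoint_exists(1)[OF U]] by blast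
qed

text \<open>Coordinate \<open>i\<close> of \<open>S x\<close> is the inner product of
  \<open>x\<close> with \<open>cadjoint S (ell2_unit i)\<close>, whose own coordinates are
  conjugates of matrix entries of \<open>S\<close>.\<close>

lemma ell2_operator_eqI:
  fixes S T :: "ell2 \<Rightarrow> ell2"
  assumes S: "bounded_clinear S" and T: "bounded_clinear T"
    and eq: "\<And>i j. ell2_nth (S (ell2_unit j)) i = ell2_nth (T (ell2_unit j)) i"
  shows "S = T"
proof
  fix x
  have "cadjoint S (ell2_unit i) = cadjoint T (ell2_unit i)" for i
    by (rule ell2_eqI)
      (simp add: cinner_unit_right[symmetric] ell2_adjoint_left S T,
       metis cinner_commute cinner_unit_right eq)
  then show "S x = T x"
    by (intro ell2_eqI)
      (simp add: cinner_unit_right[symmetric] ell2_adjoint_exists(2)[OF S]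
        ell2_adjoint_exists(2)[OF T])
qed

section \<open>Matrices with two superdiagonals\<close>

text \<open>Row \<open>i\<close> applied to \<open>x\<close> is at most \<open>C\<close> times the
  mean of the moduli of \<open>x\<close> up to \<open>i\<close> plus the moduli at
  \<open>i + 1\<close> and \<open>i + 2\<close>. Hardy's inequality controls the means; the other
  two terms are shifts of \<open>x\<close>.\<close>

lemma ell2_matrix_op_hessenberg:
  fixes t :: "nat \<Rightarrow> nat \<Rightarrow> real"
  assumes zero: "\<And>i j. j > i + 2 \<Longrightarrow> t i j = 0"
    and low: "\<And>i j. j \<le> i + 1 \<Longrightarrow> \<bar>t i j\<bar> \<le> C / real (Suc i)"
    and sup2: "\<And>i. \<bar>t i (i + 2)\<bar> \<le> C"
  defines "T \<equiv> ell2_matrix_op (\<lambda>i j. complex_of_real (t i j))"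
  shows "ell2_nth (T x) i = (\<Sum>j\<le>i + 2. complex_of_real (t i j) * ell2_nth x j)"
    and "bounded_clinear T"
proof -
  have C: "0 \<le> C"
    using sup2[of 0] by linarith
  have sup1: "\<bar>t i (i + 1)\<bar> \<le> C" for i
  proof -
    have "C / real (Suc i) \<le> C / 1"
      using C by (intro divide_left_mono) auto
    then show ?thesis
      using low[of "i + 1" i] by simp
  qed
  have row: "(\<Sum>j. complex_of_real (t i j) * f j) = (\<Sum>j\<le>i + 2. complex_of_real (t i j) * f j)" for i f
    by (rule suminf_finite) (auto simp: zero)
  have bound: "(\<Sum>i<N. (cmod (\<Sum>j\<le>i + 2. complex_of_real (t i j) * ell2_nth x j))\<^sup>2)
                 \<le> (5 * C * norm x)\<^sup>2" for N x
  proof -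
    let ?a = "\<lambda>j. cmod (ell2_nth x j)"
    let ?m = "\<lambda>i. (\<Sum>j\<le>i. ?a j) / real (Suc i)"
    have "(cmod (\<Sum>j\<le>i + 2. complex_of_real (t i j) * ell2_nth x j))\<^sup>2
            \<le> 3 * C\<^sup>2 * ((?m i)\<^sup>2 + (?a (i + 1))\<^sup>2 + (?a (i + 2))\<^sup>2)" for i
    proof -
      have "cmod (\<Sum>j\<le>i + 2. complex_of_real (t i j) * ell2_nth x j)
              \<le> (\<Sum>j\<le>i + 2. \<bar>t i j\<bar> * ?a j)"
        by (rule sum_norm_le) (simp add: norm_mult)
      also have "\<dots> = (\<Sum>j\<le>i. \<bar>t i j\<bar> * ?a j) + \<bar>t i (i + 1)\<bar> * ?a (i + 1) + \<bar>t i (i + 2)\<bar> * ?a (i + 2)"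
        by (simp add: numeral_2_eq_2)
      also have "\<dots> \<le> (\<Sum>j\<le>i. C / real (Suc i) * ?a j) + C * ?a (i + 1) + C * ?a (i + 2)"
        by (intro add_mono sum_mono mult_right_mono low sup1 sup2) auto
      also have "\<dots> = C * (?m i + ?a (i + 1) + ?a (i + 2))"
        by (simp add: sum_distrib_left sum_divide_distrib distrib_left)
      finally have "(cmod (\<Sum>j\<le>i + 2. complex_of_real (t i j) * ell2_nth x j))\<^sup>2
                      \<le> (C * (?m i + ?a (i + 1) + ?a (i + 2)))\<^sup>2"
        by (intro power_mono) auto
      also have "\<dots> = C\<^sup>2 * (?m i + ?a (i + 1) + ?a (i + 2))\<^sup>2"
        by (rule power_mult_distrib)
      also have "\<dots> \<le> C\<^sup>2 * (3 * ((?m i)\<^sup>2 + (?a (i + 1))\<^sup>2 + (?a (i + 2))\<^sup>2))"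
      proof (rule mult_left_mono)
        have "(p + q + r)\<^sup>2 \<le> 3 * (p\<^sup>2 + q\<^sup>2 + r\<^sup>2)" for p q r :: real
          using zero_le_power2[of "p - q"] zero_le_power2[of "p - r"] zero_le_power2[of "q - r"]
          by (simp add: power2_eq_square algebra_simps)
        then show "(?m i + ?a (i + 1) + ?a (i + 2))\<^sup>2
                     \<le> 3 * ((?m i)\<^sup>2 + (?a (i + 1))\<^sup>2 + (?a (i + 2))\<^sup>2)" .
      qed simp
      finally show ?thesis
        by (simp only: mult.assoc mult.left_commute)
    qed
    then have "(\<Sum>i<N. (cmod (\<Sum>j\<le>i + 2. complex_of_real (t i j) * ell2_nth x j))\<^sup>2)
            \<le> (\<Sum>i<N. 3 * C\<^sup>2 * ((?m i)\<^sup>2 + (?a (i + 1))\<^sup>2 + (?a (i + 2))\<^sup>2))"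
      by (rule sum_mono)
    also have "\<dots> = 3 * C\<^sup>2 * ((\<Sum>i<N. (?m i)\<^sup>2) + (\<Sum>i<N. (?a (i + 1))\<^sup>2) + (\<Sum>i<N. (?a (i + 2))\<^sup>2))"
      by (simp only: sum_distrib_left[symmetric] sum.distrib)
    also have "\<dots> \<le> 3 * C\<^sup>2 * (4 * (norm x)\<^sup>2 + (norm x)\<^sup>2 + (norm x)\<^sup>2)"
    proof (intro mult_left_mono add_mono)
      have "(\<Sum>i<N. (?m i)\<^sup>2) \<le> 4 * (\<Sum>n<N. (?a n)\<^sup>2)"
      proof -
        have "0 \<le> 2 * (\<Sum>j<N. ?a j)\<^sup>2 / real N"
          by simp
        then show ?thesis
          using hardy_partial_sums[of ?a N] by linarith
      qed
      then show "(\<Sum>i<N. (?m i)\<^sup>2) \<le> 4 * (norm x)\<^sup>2"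
        using sum_le_norm_ell2[of x N] by linarith
      have shift: "(\<Sum>i<N. (?a (i + s))\<^sup>2) \<le> (norm x)\<^sup>2" for s
      proof -
        have "(\<Sum>i<N. (?a (i + s))\<^sup>2) = (\<Sum>i\<in>(\<lambda>i. i + s) ` {..<N}. (?a i)\<^sup>2)"
          by (subst sum.reindex) auto
        also have "\<dots> \<le> (\<Sum>i<N + s. (?a i)\<^sup>2)"
          by (rule sum_mono2) auto
        finally show ?thesis
          using sum_le_norm_ell2[of x "N + s"] by linarith
      qed
      show "(\<Sum>i<N. (?a (i + 1))\<^sup>2) \<le> (norm x)\<^sup>2" "(\<Sum>i<N. (?a (i + 2))\<^sup>2) \<le> (norm x)\<^sup>2"
        by (rule shift)+
    qed simp
    \<comment> \<open>The constant reached is 3 (4 + 1 + 1) = 18, below 5^2.\<close>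
    also have "\<dots> \<le> (5 * C * norm x)\<^sup>2"
      using mult_nonneg_nonneg[OF zero_le_power2[of C] zero_le_power2[of "norm x"]]
      by (simp add: power_mult_distrib)
    finally show ?thesis .
  qed
  have nth: "ell2_nth (T x) i = (\<Sum>j\<le>i + 2. complex_of_real (t i j) * ell2_nth x j)" for x i
    using ell2_bounded_partial_sums(1)[OF bound, of x] C
    by (simp add: T_def ell2_matrix_op_def row Abs_ell2_inverse)
  then show "ell2_nth (T x) i = (\<Sum>j\<le>i + 2. complex_of_real (t i j) * ell2_nth x j)" .
  show "bounded_clinear T"
    unfolding bounded_clinear_def
  proof (intro conjI allI bounded_linear_intro)
    fix x y :: ell2 and r :: real and c :: complex
    show "T (x + y) = T x + T y"
      by (rule ell2_eqI) (simp only: nth plus_ell2.rep_eq distrib_left sum.distrib)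
    show "T (r *\<^sub>R x) = r *\<^sub>R T x"
      by (rule ell2_eqI) (simp only: nth scaleR_ell2.rep_eq scaleR_sum_right mult_scaleR_right)
    show "T (c *\<^sub>C x) = c *\<^sub>C T x"
      by (rule ell2_eqI) (simp only: nth scaleC_ell2.rep_eq sum_distrib_left mult.left_commute)
    show "norm (T x) \<le> norm x * (5 * C)"
      using ell2_bounded_partial_sums(2)[OF bound, of x] C
      by (simp only: T_def ell2_matrix_op_def row mult.commute[of "norm x"]) simp
  qed
qed

section \<open>The factorizations of the generalized Cesaro matrix\<close>

text \<open>At j = i + 1 the numerator vanishes, so the closed form reaches one step above the
  diagonal. Differences can then be computed up to the first superdiagonal without case
  splits.\<close>

lemma cesaro2_entry_formula:
  assumes "j \<le> i + 1"
  shows "cesaro2_entry \<alpha> i j = 2 * (real i + 1 - real j) / ((real i + 1 + \<alpha>) * (real i + 2 + \<alpha>))"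
  using assms by (cases "j = i + 1") (auto simp: cesaro2_entry_def)

text \<open>The second backward difference of the extension of \<open>g\<close> by zero to negative indices.\<close>

definition bdiff2 :: "(nat \<Rightarrow> real) \<Rightarrow> nat \<Rightarrow> real" where
  "bdiff2 g j = g j - 2 * (if j \<ge> 1 then g (j - 1) else 0) + (if j \<ge> 2 then g (j - 2) else 0)"

text \<open>The matrices of the operators \<open>T\<close> and \<open>U\<close> with \<open>M = M\<^sup>* T\<close> and \<open>M = U M\<^sup>*\<close>.\<close>

definition cesaro2_fwd :: "real \<Rightarrow> nat \<Rightarrow> nat \<Rightarrow> real" where
  "cesaro2_fwd \<alpha> k j =
     (cesaro2_entry \<alpha> k j - 2 * cesaro2_entry \<alpha> (k + 1) j + cesaro2_entry \<alpha> (k + 2) j)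
       * ((real k + 1 + \<alpha>) * (real k + 2 + \<alpha>)) / 2"

definition cesaro2_bwd :: "real \<Rightarrow> nat \<Rightarrow> nat \<Rightarrow> real" where
  "cesaro2_bwd \<alpha> k =
     bdiff2 (\<lambda>j. cesaro2_entry \<alpha> k j * ((real j + 1 + \<alpha>) * (real j + 2 + \<alpha>)) / 2)"

text \<open>The second difference down a column of M is O(1/k^3), and division by d_k, of order
  1/k^2, leaves O(1/k). On the second superdiagonal only the diagonal entry of row
  \<open>k + 2\<close> survives, giving the ratio of d_(k+2) to d_k, which is below 1.\<close>

lemma cesaro2_fwd_bounds:
  assumes \<alpha>: "\<alpha> > -1"
  shows "j > k + 2 \<Longrightarrow> cesaro2_fwd \<alpha> k j = 0"
    and "j \<le> k + 1 \<Longrightarrow> \<bar>cesaro2_fwd \<alpha> k j\<bar> \<le> 4 / real (Suc k)"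
    and "\<bar>cesaro2_fwd \<alpha> k (k + 2)\<bar> \<le> 4"
proof -
  define p where "p = real k + 1 + \<alpha>"
  have p: "p > 0" "p > real k"
    using \<alpha> by (auto simp: p_def)
  show "j > k + 2 \<Longrightarrow> cesaro2_fwd \<alpha> k j = 0"
    by (simp add: cesaro2_fwd_def cesaro2_entry_def)
  show "\<bar>cesaro2_fwd \<alpha> k (k + 2)\<bar> \<le> 4"
  proof -
    have "cesaro2_entry \<alpha> (k + 2) (k + 2) = 2 / ((p + 2) * (p + 3))"
      by (simp add: cesaro2_entry_def p_def algebra_simps)
    moreover have "(real k + 1 + \<alpha>) * (real k + 2 + \<alpha>) = p * (p + 1)"
      by (simp add: p_def)
    ultimately have "cesaro2_fwd \<alpha> k (k + 2) = p * (p + 1) / ((p + 2) * (p + 3))"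
      unfolding cesaro2_fwd_def by (simp add: cesaro2_entry_def[of _ k] cesaro2_entry_def[of _ "Suc k"])
    also have "\<bar>\<dots>\<bar> \<le> 1"
      using p by (simp add: divide_le_eq_1) (simp add: algebra_simps)
    finally show ?thesis
      by simp
  qed
  assume j: "j \<le> k + 1"
  define x where "x = real k + 1 - real j"
  have x: "0 \<le> x" "x < p + 1"
    using j \<alpha> by (auto simp: x_def p_def)
  have "cesaro2_fwd \<alpha> k j = (2 * x / (p * (p + 1)) - 2 * (2 * (x + 1) / ((p + 1) * (p + 2)))
          + 2 * (x + 2) / ((p + 2) * (p + 3))) * (p * (p + 1)) / 2"
    using j by (simp add: cesaro2_fwd_def cesaro2_entry_formula p_def x_def algebra_simps)
  \<comment> \<open>Over the common denominator the higher powers of \<open>p\<close> cancel: the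
    coefficient of \<open>x\<close> reduces to 6 and the remaining terms to -4p.\<close>
  also have "\<dots> = 2 * (3 * x - 2 * p) / ((p + 2) * (p + 3))"
    using p(1) by (simp add: divide_simps) (simp add: algebra_simps)
  \<comment> \<open>From 0 \<le> x < p + 1 follows -2p \<le> 3x - 2p < p + 3.\<close>
  also have "\<bar>\<dots>\<bar> \<le> 4 * (p + 3) / ((p + 2) * (p + 3))"
    using p x by (simp add: abs_mult divide_right_mono)
  also have "\<dots> = 4 / (p + 2)"
    using p by (intro mult_divide_mult_cancel_right) auto
  also have "\<dots> \<le> 4 / real (Suc k)"
    using p by (intro divide_left_mono) auto
  finally show "\<bar>cesaro2_fwd \<alpha> k j\<bar> \<le> 4 / real (Suc k)" .
qed

lemma bdiff2_cmult: "(\<And>i. i \<le> j \<Longrightarrow> g i = c * f i) \<Longrightarrow> bdiff2 g j = c * bdiff2 f j"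
  by (simp add: bdiff2_def algebra_simps)

text \<open>Dividing its entries by d_j turns row \<open>k\<close> of M into d_k times a cubic in
  \<open>j\<close>. The second difference of a cubic is linear, hence O(k) in this range, and d_k is
  O(1/k^2).\<close>

lemma cesaro2_bwd_bounds:
  assumes \<alpha>: "\<alpha> > -1"
  defines "C \<equiv> 8 * (2 + \<alpha>) * (3 + \<alpha>) / min 1 (1 + \<alpha>)"
  shows "j > k + 2 \<Longrightarrow> cesaro2_bwd \<alpha> k j = 0"
    and "j \<le> k + 1 \<Longrightarrow> \<bar>cesaro2_bwd \<alpha> k j\<bar> \<le> C / real (Suc k)"
    and "\<bar>cesaro2_bwd \<alpha> k (k + 2)\<bar> \<le> C"
proof -
  define c where "c = min 1 (1 + \<alpha>)"
  have c: "0 < c" "c \<le> 1" "c \<le> 1 + \<alpha>"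
    using \<alpha> by (auto simp: c_def)
  define E where "E = 4 * (2 + \<alpha>) * (3 + \<alpha>)"
  have C_eq: "C = 2 * E / c"
    by (simp add: C_def E_def c_def)
  have E: "E = 24 + 20 * \<alpha> + 4 * (\<alpha> * \<alpha>)"
    by (simp add: E_def algebra_simps)
  \<comment> \<open>The first bound serves the columns j \<ge> 2, the second the columns 0 and 1,
    where \<open>bdiff2\<close> is cut off.\<close>
  have E_ge: "E \<ge> 4 * (2 + \<alpha>)" "E \<ge> (2 + \<alpha>) * (3 + \<alpha>) + 2 * ((1 + \<alpha>) * (2 + \<alpha>))"
    using \<alpha> zero_le_square[of \<alpha>] mult_pos_pos[of "1 + \<alpha>" "1 + \<alpha>"]
    by (auto simp: E algebra_simps)
  have E_pos: "E \<ge> 4"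
    using E_ge(1) \<alpha> by simp
  show "j > k + 2 \<Longrightarrow> cesaro2_bwd \<alpha> k j = 0"
    by (auto simp: cesaro2_bwd_def bdiff2_def cesaro2_entry_def)
  show "\<bar>cesaro2_bwd \<alpha> k (k + 2)\<bar> \<le> C"
  proof -
    have "(real k + 1 + \<alpha>) * (real k + 2 + \<alpha>) \<noteq> 0"
      using \<alpha> by auto
    \<comment> \<open>Of the three terms only the one at column \<open>k\<close> survives; there the
      diagonal entry d_k is divided by d_k.\<close>
    then have "cesaro2_bwd \<alpha> k (k + 2) = 1"
      by (simp add: cesaro2_bwd_def bdiff2_def cesaro2_entry_def)
    moreover have "1 \<le> C"
      unfolding C_eq using c E_pos by (simp add: le_divide_eq_1)
    ultimately show ?thesis
      by simp
  qed
  assume j: "j \<le> k + 1"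
  define n where "n = real k + 1"
  define w where "w j = (n - real j) * ((real j + 1 + \<alpha>) * (real j + 2 + \<alpha>)) / 2" for j
  have n: "n \<ge> 1" "real j \<le> n"
    using j by (auto simp: n_def)
  have w: "\<bar>bdiff2 w j\<bar> \<le> E * n"
  proof -
    consider "j = 0" | "j = 1" | i where "j = i + 2"
      by (metis One_nat_def add_2_eq_Suc' not0_implies_Suc)
    then show ?thesis
    proof cases
      case 1
      have pos: "0 \<le> (1 + \<alpha>) * (2 + \<alpha>)" "0 \<le> (2 + \<alpha>) * (3 + \<alpha>)"
        using \<alpha> by simp_all
      then have "(1 + \<alpha>) * (2 + \<alpha>) / 2 \<le> E"
        using E_ge(2) by linarith
      with pos(1) have "0 \<le> n * ((1 + \<alpha>) * (2 + \<alpha>))" "n * ((1 + \<alpha>) * (2 + \<alpha>) / 2) \<le> n * E"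
        using n by (auto intro!: mult_left_mono)
      then show ?thesis
        using 1 by (simp add: bdiff2_def w_def mult.commute)
    next
      case 2
      let ?b = "(2 + \<alpha>) * (3 + \<alpha>) / 2" and ?a = "(1 + \<alpha>) * (2 + \<alpha>)"
      have "bdiff2 w j = (n - 1) * ?b - n * ?a"
        using 2 by (simp add: bdiff2_def w_def)
      also have "\<bar>\<dots>\<bar> \<le> (n - 1) * ?b + n * ?a"
        using abs_triangle_ineq4[of "(n - 1) * ?b" "n * ?a"] \<alpha> n
        by (simp add: abs_mult)
      also have "\<dots> \<le> n * ?b + n * ?a"
        using \<alpha> by simp
      also have "\<dots> = n * (?b + ?a)"
        by (simp only: distrib_left)
      also have "\<dots> \<le> n * E"
      proof (rule mult_left_mono)
        have "0 \<le> (1 + \<alpha>) * (2 + \<alpha>)" "0 \<le> (2 + \<alpha>) * (3 + \<alpha>)"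
          using \<alpha> by simp_all
        then show "?b + ?a \<le> E"
          using E_ge(2) by linarith
      qed (use n in simp)
      finally show ?thesis
        by (simp only: mult.commute)
    next
      case 3
      have "bdiff2 w j = n - real j - 2 * (real j + \<alpha>)"
      proof -
        \<comment> \<open>A backward step in \<open>j\<close> raises z = n - j by one and lowers y =
          j + \<alpha> by one.\<close>
        have "z * ((y + 1) * (y + 2)) / 2 - 2 * ((z + 1) * (y * (y + 1)) / 2)
                + (z + 2) * ((y - 1) * y) / 2 = z - 2 * y" for y z :: real
          by (simp add: field_simps)
        from this[of "n - real j" "real j + \<alpha>"] show ?thesis
          using 3 by (simp add: bdiff2_def w_def add_ac diff_diff_eq)
      qed
      moreover have "2 * (real j + \<alpha>) \<le> E * n" "n - real j \<le> E * n"
      proof -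
        have "\<alpha> \<le> (1 + \<alpha>) * n"
        proof -
          have "\<alpha> \<le> (1 + \<alpha>) * 1"
            by simp
          also have "\<dots> \<le> (1 + \<alpha>) * n"
            using n \<alpha> by (intro mult_left_mono) auto
          finally show ?thesis .
        qed
        then have "2 * (real j + \<alpha>) \<le> 4 * (2 + \<alpha>) * n"
          using n \<alpha> by (simp add: algebra_simps)
        also have "\<dots> \<le> E * n"
          using E_ge n by (intro mult_right_mono) auto
        finally show "2 * (real j + \<alpha>) \<le> E * n" .
        have "1 * n \<le> E * n"
          using E_pos n by (intro mult_right_mono) auto
        then show "n - real j \<le> E * n"
          by simp
      qed
      ultimately show ?thesis
        using 3 n \<alpha> by (simp add: abs_le_iff)
    qed
  qed
  define p where "p = n + \<alpha>"
  \<comment> \<open>For negative \<alpha> \<open>p\<close> is smaller than \<open>n\<close>; the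
    factor \<open>c\<close> keeps a lower bound of order \<open>n\<close>. The second factor p + 1
    of the denominator is at least \<open>n\<close>.\<close>
  have p: "c * n \<le> p" "n \<le> p + 1" "0 < p"
  proof -
    have "c * n = c * (n - 1) + c"
      by (simp add: algebra_simps)
    also have "\<dots> \<le> (n - 1) + (1 + \<alpha>)"
      using c n by (intro add_mono) (auto simp: mult_left_le_one_le)
    finally show "c * n \<le> p"
      by (simp add: p_def)
    show "n \<le> p + 1" "0 < p"
      using \<alpha> n by (auto simp: p_def)
  qed
  have "cesaro2_bwd \<alpha> k j = 2 / (p * (p + 1)) * bdiff2 w j"
    unfolding cesaro2_bwd_def
  proof (rule bdiff2_cmult)
    fix i assume "i \<le> j"
    then have "cesaro2_entry \<alpha> k i = 2 * (n - real i) / (p * (p + 1))"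
      using j by (simp add: cesaro2_entry_formula p_def n_def add_ac)
    moreover have "2 * x / r * y / 2 = 2 / r * (x * y / 2)" for x r y :: real
      by simp
    ultimately show "cesaro2_entry \<alpha> k i * ((real i + 1 + \<alpha>) * (real i + 2 + \<alpha>)) / 2
                 = 2 / (p * (p + 1)) * w i"
      by (simp only: w_def)
  qed
  also have "\<bar>\<dots>\<bar> = 2 / (p * (p + 1)) * \<bar>bdiff2 w j\<bar>"
    using p by (simp add: abs_mult)
  also have "\<dots> \<le> 2 / (c * n * n) * (E * n)"
    using p c n E_pos by (intro mult_mono w divide_left_mono) auto
  also have "\<dots> = C / n"
    using c n by (simp add: C_eq)
  also have "n = real (Suc k)"
    by (simp add: n_def)
  finally show "\<bar>cesaro2_bwd \<alpha> k j\<bar> \<le> C / real (Suc k)" .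
qed

section \<open>Summation formulas that invert second differences\<close>

lemma sum_bdiff2:
  "(\<Sum>j\<le>i. bdiff2 g j) = g i - (if i \<ge> 1 then g (i - 1) else 0)"
  by (induction i) (auto simp: bdiff2_def Suc_le_eq numeral_2_eq_2)

text \<open>The weights are the entries of L^2 for the lower triangular all-ones matrix L, and
  \<open>bdiff2\<close> is (I - S)^2 with S the unilateral shift, so this is L^2 (I - S)^2 = I. Each
  induction step adds one unweighted sum, which telescopes.\<close>

lemma sum_weighted_bdiff2:
  "(\<Sum>j\<le>i. (real i + 1 - real j) * bdiff2 g j) = g i"
proof (induction i)
  case 0
  show ?case
    by (simp add: bdiff2_def)
next
  case (Suc i)
  have "(\<Sum>j\<le>Suc i. (real (Suc i) + 1 - real j) * bdiff2 g j)
          = (\<Sum>j\<le>i. (real i + 1 - real j) * bdiff2 g j) + (\<Sum>j\<le>Suc i. bdiff2 g j)"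
    by (simp add: algebra_simps sum.distrib sum_subtractf sum_distrib_left)
  then show ?case
    unfolding Suc.IH sum_bdiff2 by simp
qed

text \<open>This is entry (k, i) of U M' = M. The factor \<open>?d\<close> cancels the division by
  d_i inside \<open>cesaro2_bwd\<close>.\<close>

lemma sum_cesaro2_bwd_cesaro2_entry:
  assumes \<alpha>: "\<alpha> > -1"
  shows "(\<Sum>j\<le>k + 2. cesaro2_bwd \<alpha> k j * cesaro2_entry \<alpha> i j) = cesaro2_entry \<alpha> k i"
proof -
  let ?d = "2 / ((real i + 1 + \<alpha>) * (real i + 2 + \<alpha>))"
  \<comment> \<open>Row \<open>k\<close> of U ends at \<open>k + 2\<close> and row \<open>i\<close>
    of M at \<open>i\<close>; a common larger range allows the sum to end at \<open>i\<close>
    instead.\<close>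
  have "(\<Sum>j\<le>k + 2. cesaro2_bwd \<alpha> k j * cesaro2_entry \<alpha> i j)
          = (\<Sum>j\<le>k + 2 + i. cesaro2_bwd \<alpha> k j * cesaro2_entry \<alpha> i j)"
    by (rule sum.mono_neutral_left) (auto simp: cesaro2_bwd_bounds(1)[OF \<alpha>])
  also have "\<dots> = (\<Sum>j\<le>i. cesaro2_bwd \<alpha> k j * cesaro2_entry \<alpha> i j)"
    by (rule sum.mono_neutral_right) (auto simp: cesaro2_entry_def)
  also have "\<dots> = (\<Sum>j\<le>i. ?d * ((real i + 1 - real j) * cesaro2_bwd \<alpha> k j))"
    by (rule sum.cong) (auto simp: cesaro2_entry_def)
  also have "\<dots> = ?d * (\<Sum>j\<le>i. (real i + 1 - real j) * cesaro2_bwd \<alpha> k j)"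
    by (rule sum_distrib_left[symmetric])
  also have "\<dots> = cesaro2_entry \<alpha> k i"
    using \<alpha> by (simp add: cesaro2_bwd_def sum_weighted_bdiff2)
  finally show ?thesis .
qed

text \<open>This is entry (i, j) of M' T = M, an infinite sum because M' is upper triangular. The
  factors d_k cancel and leave the weight k + 1 - i against a second difference; summation by parts
  telescopes this up to boundary terms.\<close>

lemma cesaro2_fwd_cesaro2_entry_sums:
  assumes \<alpha>: "\<alpha> > -1"
  shows "(\<lambda>k. cesaro2_fwd \<alpha> k j * cesaro2_entry \<alpha> k i) sums cesaro2_entry \<alpha> i j"
proof -
  let ?h = "\<lambda>k. cesaro2_entry \<alpha> k j"
  \<comment> \<open>Terms with k < i vanish, so \<open>n\<close> counts the summands from
    \<open>i\<close> on.\<close>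
  have partial: "(\<Sum>k<i + n. cesaro2_fwd \<alpha> k j * cesaro2_entry \<alpha> k i)
      = ?h i - (real n + 1) * ?h (n + i) + real n * ?h (n + i + 1)" for n
  proof (induction n)
    case 0
    show ?case
      by (simp add: cesaro2_entry_def)
  next
    case (Suc n)
    let ?p = "real (i + n) + 1 + \<alpha>" and ?q = "real (i + n) + 2 + \<alpha>"
    have "?p > 0" "?q > 0"
      using \<alpha> by auto
    moreover have "cesaro2_entry \<alpha> (i + n) i = 2 * (real n + 1) / (?p * ?q)"
      by (simp add: cesaro2_entry_def)
    moreover have "x * (p * q) / 2 * (2 * m / (p * q)) = m * x" if "p > 0" "q > 0" for x p q m :: real
      using that by simp
    ultimately have "cesaro2_fwd \<alpha> (i + n) j * cesaro2_entry \<alpha> (i + n) i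
            = (real n + 1) * (?h (i + n) - 2 * ?h (i + n + 1) + ?h (i + n + 2))"
      by (simp only: cesaro2_fwd_def)
    with Suc.IH show ?case
      by (simp add: algebra_simps)
  qed
  \<comment> \<open>The two boundary terms tend to -2 and 2, so they vanish only jointly.\<close>
  have "(\<lambda>n. ?h i - (real n + 1) * (2 * (real n + real i + 1 - real j) / ((real n + real i + 1 + \<alpha>) * (real n + real i + 2 + \<alpha>)))
          + real n * (2 * (real n + real i + 1 + 1 - real j) / ((real n + real i + 1 + 1 + \<alpha>) * (real n + real i + 1 + 2 + \<alpha>))))
        \<longlonglongrightarrow> ?h i"
    by real_asymp
  moreover have "\<forall>\<^sub>F n in sequentially. ?h i - (real n + 1) * (2 * (real n + real i + 1 - real j) / ((real n + real i + 1 + \<alpha>) * (real n + real i + 2 + \<alpha>)))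
          + real n * (2 * (real n + real i + 1 + 1 - real j) / ((real n + real i + 1 + 1 + \<alpha>) * (real n + real i + 1 + 2 + \<alpha>)))
     = (\<Sum>k<i + n. cesaro2_fwd \<alpha> k j * cesaro2_entry \<alpha> k i)"
    \<comment> \<open>For n \<ge> j the closed form applies to both boundary entries.\<close>
    using eventually_ge_at_top[of j]
    by eventually_elim (simp only: partial, simp add: cesaro2_entry_formula add_ac)
  ultimately have "(\<lambda>n. \<Sum>k<i + n. cesaro2_fwd \<alpha> k j * cesaro2_entry \<alpha> k i) \<longlonglongrightarrow> ?h i"
    by (rule Lim_transform_eventually)
  then show ?thesis
    unfolding sums_def by (subst (asm) add.commute) (rule LIMSEQ_offset)
qed

section \<open>The two factorizations as operator identities\<close>

lemma cesaro2_unit_nth: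
  assumes "\<alpha> > -1"
  shows "ell2_nth (cesaro2 \<alpha> (ell2_unit j)) i = complex_of_real (cesaro2_entry \<alpha> i j)"
  by (simp add: cesaro2_nth[OF assms] if_distrib[of "\<lambda>x. _ * x"] cesaro2_entry_def cong: if_cong)

theorem corollary2p2:
  fixes \<alpha> :: real
  assumes "\<alpha> > -1"
  shows "posinormal (cesaro2 \<alpha>) \<and> coposinormal (cesaro2 \<alpha>)"
proof
  note M = bounded_clinear_cesaro2[OF assms]
  note M' = ell2_adjoint_exists(1)[OF M]
  note M_adj = ell2_adjoint_left[OF M]
  define T where "T = ell2_matrix_op (\<lambda>k j. complex_of_real (cesaro2_fwd \<alpha> k j))"
  have T_row: "ell2_nth (T x) k = (\<Sum>j\<le>k + 2. complex_of_real (cesaro2_fwd \<alpha> k j) * ell2_nth x j)"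
    and T: "bounded_clinear T" for x k
    unfolding T_def
    by (rule ell2_matrix_op_hessenberg[where C = "4"],
        (rule cesaro2_fwd_bounds[OF assms]; assumption)+)+
  have T_nth: "ell2_nth (T (ell2_unit j)) k = complex_of_real (cesaro2_fwd \<alpha> k j)" for j k
    using cesaro2_fwd_bounds(1)[OF assms, of k j]
    by (simp add: T_row if_distrib[of "\<lambda>x. _ * x"] del: sum.atMost_Suc cong: if_cong)
  have "cesaro2 \<alpha> = cadjoint (cesaro2 \<alpha>) \<circ> T"
  proof (rule ell2_operator_eqI[OF M bounded_clinear_compose[OF M' T]])
    fix i j
    \<comment> \<open>Entry (i, j) of M' T is the inner product of \<open>T (ell2_unit j)\<close>
      with \<open>cesaro2 \<alpha> (ell2_unit i)\<close>, expanded as a series over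
      \<open>k\<close>.\<close>
    have "(\<lambda>k. ell2_nth (T (ell2_unit j)) k * cnj (ell2_nth (cesaro2 \<alpha> (ell2_unit i)) k))
            sums complex_of_real (cesaro2_entry \<alpha> i j)"
      using sums_of_real[OF cesaro2_fwd_cesaro2_entry_sums[OF assms, of j i], where 'a = complex]
      by (simp add: T_nth cesaro2_unit_nth[OF assms])
    then have "cinner (T (ell2_unit j)) (cesaro2 \<alpha> (ell2_unit i)) = complex_of_real (cesaro2_entry \<alpha> i j)"
      unfolding cinner_ell2_def using ell2_cinner_sums sums_unique2 by blast
    then show "ell2_nth (cesaro2 \<alpha> (ell2_unit j)) i
                 = ell2_nth ((cadjoint (cesaro2 \<alpha>) \<circ> T) (ell2_unit j)) i"
      by (simp add: cesaro2_unit_nth[OF assms] cinner_unit_right[symmetric, of "cadjoint _ _"] M_adj)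
  qed
  then show "posinormal (cesaro2 \<alpha>)"
    by (rule posinormalI[OF M T])
  define U where "U = ell2_matrix_op (\<lambda>k j. complex_of_real (cesaro2_bwd \<alpha> k j))"
  have U_row: "ell2_nth (U x) k = (\<Sum>j\<le>k + 2. complex_of_real (cesaro2_bwd \<alpha> k j) * ell2_nth x j)"
    and U: "bounded_clinear U" for x k
    unfolding U_def
    by (rule ell2_matrix_op_hessenberg[where C = "8 * (2 + \<alpha>) * (3 + \<alpha>) / min 1 (1 + \<alpha>)"],
        (rule cesaro2_bwd_bounds[OF assms]; assumption)+)+
  \<comment> \<open>The entries of M are real, so the adjoint has the transposed matrix without
    conjugation.\<close>
  have adj_nth: "ell2_nth (cadjoint (cesaro2 \<alpha>) (ell2_unit i)) j = complex_of_real (cesaro2_entry \<alpha> i j)"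
    for i j
    by (subst cinner_unit_right[symmetric], subst M_adj, subst cinner_commute)
      (simp add: cinner_unit_right cesaro2_unit_nth[OF assms])
  have "cesaro2 \<alpha> = U \<circ> cadjoint (cesaro2 \<alpha>)"
  proof (rule ell2_operator_eqI[OF M bounded_clinear_compose[OF U M']])
    fix i k
    have "ell2_nth ((U \<circ> cadjoint (cesaro2 \<alpha>)) (ell2_unit i)) k
            = complex_of_real (\<Sum>j\<le>k + 2. cesaro2_bwd \<alpha> k j * cesaro2_entry \<alpha> i j)"
      by (simp only: comp_apply U_row adj_nth of_real_sum of_real_mult)
    then show "ell2_nth (cesaro2 \<alpha> (ell2_unit i)) k
                 = ell2_nth ((U \<circ> cadjoint (cesaro2 \<alpha>)) (ell2_unit i)) k"
      by (simp only: sum_cesaro2_bwd_cesaro2_entry[OF assms] cesaro2_unit_nth[OF assms])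
  qed
  then show "coposinormal (cesaro2 \<alpha>)"
    by (rule coposinormalI[OF M U])
qed

end
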